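(* Let $n\ge1$ and let $\lambda\in X_+$ be a dominant weight of $SL_{n+1}(\mathbb{C})$. Let $\mathbb{B}_1(\lambda)$ be the graph with vertex set $\mathcal{B}(\lambda)$ in which $b$ and $b'$ are joined by an edge if and only if $b=w(b')$ for some $w\in W$, or one of them is obtained from the other by applying $f_n$. Then the atomic number $$Z(b)=\langle\mathrm{wt}(b),\rho^\vee\rangle+\sum_{\alpha\in\Phi_+}\varepsilon_\alpha(b)$$ is constant on each connected component of $\mathbb{B}_1(\lambda)$.
   Context: $X$ is the weight lattice of $SL_{n+1}(\mathbb{C})$, $\Phi\subset X$ its root system (type $A_n$) with simple roots $\alpha_1,\dots,\alpha_n$ in the usual order; the positive roots are $\alpha_{j,k}:=\alpha_j+\dots+\alpha_k$, $1\le j\le k\le n$, and form $\Phi_+$; $\beta^\vee$ is the coroot of $\beta$; $\rho^\vee$ is the half-sum of the positive coroots; $X_+$ is the set of dominant weights and $W\cong S_{n+1}$ the Weyl group with simple reflections $s_i$. $\mathcal{B}(\lambda)$ is the crystal of the irreducible representation of highest weight $\lambda$, with weight map $\mathrm{wt}$ and crystal operators $e_i,f_i:\mathcal{B}(\lambda)\to\mathcal{B}(\lambda)\sqcup\{0\}$, $\mathrm{wt}(f_i(b))=\mathrm{wt}(b)-\alpha_i$. $W$ acts on $\mathcal{B}(\lambda)$ by letting $s_i$ reverse each $\alpha_i$-string: $s_i(b)=f_i^{k}(b)$ if $k=\langle\mathrm{wt}(b),\alpha_i^\vee\rangle\ge0$, and $s_i(b)=e_i^{-k}(b)$ if $k<0$.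 Modified crystal operators: for $\alpha=\alpha_{j,k}\in\Phi_+$, $f_\alpha:=wf_kw^{-1}$ and $e_\alpha:=we_kw^{-1}$ with $w=s_js_{j+1}\cdots s_{k-1}$. For $b\in\mathcal{B}(\lambda)$, $\varepsilon_\alpha(b):=\max\{N\ge 0\mid e_\alpha^N(b)\ne0\}$. The connected components of $\mathbb{B}_1(\lambda)$ are the atoms of an atomic decomposition of $\mathcal{B}(\lambda)$ (the Lecouvey–Lenart atoms). *)

theory Defs
  imports Complex_Main "HOL-Combinatorics.Permutations"
begin

text \<open>
  A weight of SL(n+1) is given by its coordinates in the basis of fundamental weights
  \<open>\<omega>\<^sub>1, \<dots>, \<omega>\<^sub>n\<close>: the value of \<open>x\<close> at \<open>i\<close> is the pairing of \<open>x\<close> with the simple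
  coroot of index \<open>i\<close>.
\<close>

type_synonym weight = "nat \<Rightarrow> int"

definition weight_lattice :: "nat \<Rightarrow> weight set" where
  "weight_lattice n = {x. \<forall>i. i \<notin> {1..n} \<longrightarrow> x i = 0}"

definition dominant_weights :: "nat \<Rightarrow> weight set" where
  "dominant_weights n = {x \<in> weight_lattice n. \<forall>i\<in>{1..n}. 0 \<le> x i}"

text \<open>
  The pair \<open>(j, k)\<close> stands for the positive root \<open>\<alpha>\<^sub>j + \<dots> + \<alpha>\<^sub>k\<close>. Its coroot is
  the sum of the simple coroots of indices \<open>j, \<dots>, k\<close>.
\<close>

definition positive_roots :: "nat \<Rightarrow> (nat \<times> nat) set" where
  "positive_roots n = {(j, k). 1 \<le> j \<and> j \<le> k \<and> k \<le> n}"

definition coroot_pairing :: "weight \<Rightarrow> nat \<times> nat \<Rightarrow> int" where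
  "coroot_pairing x = (\<lambda>(j, k). \<Sum>i = j..k. x i)"

definition rho_check_pairing :: "nat \<Rightarrow> weight \<Rightarrow> real" where
  "rho_check_pairing n x = (1/2) * (\<Sum>\<alpha>\<in>positive_roots n. of_int (coroot_pairing x \<alpha>))"

text \<open>
  The crystal of highest weight \<open>\<lambda>\<close> is realised, following Kashiwara and Nakashima, by the
  semistandard tableaux with entries in \<open>{1..n+1}\<close> whose \<open>r\<close>-th row has length
  \<open>\<lambda>\<^sub>r + \<dots> + \<lambda>\<^sub>n\<close>. A tableau is a list of rows (some possibly empty), the topmost, longest
  row first, and it is identified with its reading word: the rows from bottom to top, each read
  from left to right. Since the shape is fixed, the word determines the tableau.
\<close>

definition shape :: "nat \<Rightarrow> weight \<Rightarrow> nat list" where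
  "shape n lam = map (\<lambda>r. nat (\<Sum>i = r..n. lam i)) [1..<n+1]"

definition ssyt :: "nat \<Rightarrow> weight \<Rightarrow> nat list list set" where
  "ssyt n lam = {T. map length T = shape n lam \<and>
     (\<forall>row\<in>set T. sorted row \<and> set row \<subseteq> {1..n+1}) \<and>
     (\<forall>r c. Suc r < length T \<and> c < length (T ! Suc r) \<longrightarrow> T ! r ! c < T ! Suc r ! c)}"

definition reading_word :: "nat list list \<Rightarrow> nat list" where
  "reading_word T = concat (rev T)"

definition crystal :: "nat \<Rightarrow> weight \<Rightarrow> nat list set" where
  "crystal n lam = reading_word ` ssyt n lam"

definition wt :: "nat \<Rightarrow> nat list \<Rightarrow> weight" where
  "wt n b = (\<lambda>i. if i \<in> {1..n} then int (count_list b i) - int (count_list b (i+1)) else 0)"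

text \<open>
  Signature rule for index \<open>i\<close>: every letter \<open>i+1\<close> is an opening bracket and every letter \<open>i\<close>
  a closing bracket. A closing bracket at position \<open>p\<close> is unmatched iff every factor of the
  word ending at \<open>p\<close> contains more closing than opening brackets, and symmetrically for
  opening brackets.  The unmatched letters then read \<open>i \<dots> i (i+1) \<dots> (i+1)\<close>; the operator
  \<open>f\<^sub>i\<close> raises the last unmatched \<open>i\<close>, and \<open>e\<^sub>i\<close> lowers the first unmatched \<open>i+1\<close>.
  The value \<open>None\<close> plays the role of the extra element 0.
\<close>

definition factor :: "nat list \<Rightarrow> nat \<Rightarrow> nat \<Rightarrow> nat list" where
  "factor b p q = take (Suc q - p) (drop p b)"

definition unmatched_lower :: "nat \<Rightarrow> nat list \<Rightarrow> nat set" where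
  "unmatched_lower i b = {p. p < length b \<and> b ! p = i \<and>
     (\<forall>q\<le>p. count_list (factor b q p) (i+1) < count_list (factor b q p) i)}"

definition unmatched_upper :: "nat \<Rightarrow> nat list \<Rightarrow> nat set" where
  "unmatched_upper i b = {p. p < length b \<and> b ! p = i+1 \<and>
     (\<forall>q. p \<le> q \<and> q < length b \<longrightarrow>
        count_list (factor b p q) i < count_list (factor b p q) (i+1))}"

definition crystal_f :: "nat \<Rightarrow> nat list \<Rightarrow> nat list option" where
  "crystal_f i b = (if unmatched_lower i b = {} then None
                    else Some (b[Max (unmatched_lower i b) := i+1]))"

definition crystal_e :: "nat \<Rightarrow> nat list \<Rightarrow> nat list option" where
  "crystal_e i b = (if unmatched_upper i b = {} then None
                    else Some (b[Min (unmatched_upper i b) := i]))"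

definition iterate :: "('a \<Rightarrow> 'a option) \<Rightarrow> nat \<Rightarrow> 'a \<Rightarrow> 'a option" where
  "iterate g N b = ((\<lambda>x. Option.bind x g) ^^ N) (Some b)"

definition simple_action :: "nat \<Rightarrow> nat \<Rightarrow> nat list \<Rightarrow> nat list" where
  "simple_action n i b =
     (let k = coroot_pairing (wt n b) (i, i)
      in if 0 \<le> k then the (iterate (crystal_f i) (nat k) b)
         else the (iterate (crystal_e i) (nat (- k)) b))"

text \<open>The word \<open>[i\<^sub>1, \<dots>, i\<^sub>l]\<close> acts as the composition \<open>s\<^bsub>i\<^sub>1\<^esub> \<circ> \<dots> \<circ> s\<^bsub>i\<^sub>l\<^esub>\<close>.\<close>

definition word_action :: "nat \<Rightarrow> nat list \<Rightarrow> nat list \<Rightarrow> nat list" where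
  "word_action n is b = foldr (simple_action n) is b"

definition word_product :: "nat list \<Rightarrow> nat \<Rightarrow> nat" where
  "word_product is = foldr (\<lambda>i w. transpose i (i+1) \<circ> w) is id"

definition weyl_group :: "nat \<Rightarrow> (nat \<Rightarrow> nat) set" where
  "weyl_group n = {w. w permutes {1..n+1}}"

text \<open>
  \<open>weyl_action n w b' b\<close> says that \<open>b = w(b')\<close>. Writing \<open>w\<close> in the generators leaves a choice;
  the relation admits all of them, and they all give the same \<open>b\<close> because the actions of the
  simple reflections on a crystal satisfy the Coxeter relations.
\<close>

definition weyl_action :: "nat \<Rightarrow> (nat \<Rightarrow> nat) \<Rightarrow> nat list \<Rightarrow> nat list \<Rightarrow> bool" where
  "weyl_action n w b' b \<longleftrightarrow>
     (\<exists>is. set is \<subseteq> {1..n} \<and> word_product is = w \<and> word_action n is b' = b)"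

definition root_f :: "nat \<Rightarrow> nat \<times> nat \<Rightarrow> nat list \<Rightarrow> nat list option" where
  "root_f n = (\<lambda>(j, k) b. map_option (word_action n [j..<k])
     (crystal_f k (word_action n (rev [j..<k]) b)))"

definition root_e :: "nat \<Rightarrow> nat \<times> nat \<Rightarrow> nat list \<Rightarrow> nat list option" where
  "root_e n = (\<lambda>(j, k) b. map_option (word_action n [j..<k])
     (crystal_e k (word_action n (rev [j..<k]) b)))"

definition root_eps :: "nat \<Rightarrow> nat \<times> nat \<Rightarrow> nat list \<Rightarrow> nat" where
  "root_eps n \<alpha> b = Max {N. iterate (root_e n \<alpha>) N b \<noteq> None}"

definition atomic_number :: "nat \<Rightarrow> nat list \<Rightarrow> real" where
  "atomic_number n b =
     rho_check_pairing n (wt n b) + (\<Sum>\<alpha>\<in>positive_roots n. of_nat (root_eps n \<alpha> b))"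

definition graph_edges :: "nat \<Rightarrow> weight \<Rightarrow> (nat list \<times> nat list) set" where
  "graph_edges n lam = {(b, b'). b \<in> crystal n lam \<and> b' \<in> crystal n lam \<and>
     ((\<exists>w\<in>weyl_group n. weyl_action n w b' b) \<or>
      crystal_f n b = Some b' \<or> crystal_f n b' = Some b)}"

definition graph_components :: "nat \<Rightarrow> weight \<Rightarrow> nat list set set" where
  "graph_components n lam = crystal n lam // (graph_edges n lam \<union> (graph_edges n lam)\<inverse>)\<^sup>*"

end

theory Submission
  imports Defs
begin

text \<open>
  The string of the modified operators for a positive root \<open>\<alpha>\<close> through \<open>b\<close> has length
  \<open>\<epsilon>\<^sub>\<alpha>(b) + \<phi>\<^sub>\<alpha>(b)\<close>, and \<open>\<phi>\<^sub>\<alpha>(b) - \<epsilon>\<^sub>\<alpha>(b)\<close> is the pairing of the weight with the coroot of \<open>\<alpha>\<close>.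
  Hence the atomic number is half the sum of the lengths of all root strings through \<open>b\<close>
  (\<open>atomic_number_total_length\<close>). For \<open>\<alpha> = \<alpha>\<^sub>j + \<dots> + \<alpha>\<^sub>k\<close> the length is \<open>\<ell>\<^sub>k(s\<^sub>k\<^sub>-\<^sub>1 \<dots> s\<^sub>j(b))\<close>, where
  \<open>\<ell>\<^sub>k\<close> denotes the length of the \<open>k\<close>-string. It has to be shown that the sum is invariant under
  \<open>f\<^sub>n\<close> and under every \<open>s\<^sub>i\<close>.

  Group the roots by their last index \<open>k\<close>. The operator \<open>f\<^sub>i\<close> commutes with everything that
  involves only indices below \<open>i - 1\<close>, so it preserves the lengths for \<open>k < i - 1\<close>. For \<open>j < i\<close> the
  roots ending at \<open>i - 1\<close> and \<open>i\<close> contribute \<open>\<ell>\<^sub>i\<^sub>-\<^sub>1(x) + \<ell>\<^sub>i(s\<^sub>i\<^sub>-\<^sub>1(x))\<close> with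
  \<open>x = s\<^sub>i\<^sub>-\<^sub>2 \<dots> s\<^sub>j(b)\<close>, and this sum is invariant under \<open>f\<^sub>i\<close> (\<open>string_length_sum_crystal_f\<close>).
  So \<open>f\<^sub>i\<close>, and with it \<open>s\<^sub>i\<close>, preserves the sum over all roots with \<open>k \<le> i\<close>; for \<open>i = n\<close> these are
  all roots. The lengths with \<open>k > i\<close> are permuted by \<open>s\<^sub>i\<close> (\<open>root_length_string_refl\<close>), by the
  involution, commutation and braid relations for the \<open>s\<^sub>i\<close>.

  What remains are two facts about a pair of neighbouring indices: the braid relation and the
  invariance of \<open>\<ell>\<^sub>i\<^sub>-\<^sub>1(x) + \<ell>\<^sub>i(s\<^sub>i\<^sub>-\<^sub>1(x))\<close>. Both are obtained from row insertion of the three letters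
  involved. A word is determined by its insertion tableau and its recording data, and the crystal
  operators act on the tableau and fix the recording data. A tableau in three letters is given by
  six numbers, on which the operators and reflections are explicit piecewise linear maps, so that
  both facts become linear arithmetic with case distinctions.
\<close>

section \<open>The signature rule, read letter by letter\<close>

definition eps :: "nat \<Rightarrow> nat list \<Rightarrow> nat" where
  "eps i w = card (unmatched_upper i w)"

definition phi :: "nat \<Rightarrow> nat list \<Rightarrow> nat" where
  "phi i w = card (unmatched_lower i w)"

definition excess :: "nat \<Rightarrow> nat list \<Rightarrow> int" where
  "excess i v = int (count_list v (i+1)) - int (count_list v i)"

lemma excess_Nil [simp]: "excess i [] = 0"
  by (simp add: excess_def)

lemma excess_append: "excess i (u @ v) = excess i u + excess i v"
  by (simp add: excess_def)

lemma excess_single: "excess i [u] = (if u = i+1 then 1 else if u = i then -1 else 0)"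
  by (simp add: excess_def)

lemma factor_snoc: "q < length w \<Longrightarrow> factor (w @ [u]) p q = factor w p q"
  by (cases "p \<le> q") (auto simp: factor_def)

lemma factor_snoc_last: "p \<le> length w \<Longrightarrow> factor (w @ [u]) p (length w) = drop p w @ [u]"
  by (simp add: factor_def)

lemma factor_append_drop: "p \<le> q \<Longrightarrow> factor w p q @ drop (Suc q) w = drop p w"
proof -
  assume "p \<le> q"
  then have "drop (Suc q) w = drop (Suc q - p) (drop p w)" by simp
  then show ?thesis unfolding factor_def by (metis append_take_drop_id)
qed

lemma unmatched_lower_excess:
  "p \<in> unmatched_lower i w \<longleftrightarrow>
     p < length w \<and> w ! p = i \<and> (\<forall>q\<le>p. excess i (factor w q p) < 0)"
  by (simp add: unmatched_lower_def excess_def)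

lemma unmatched_upper_excess:
  "p \<in> unmatched_upper i w \<longleftrightarrow>
     p < length w \<and> w ! p = i+1 \<and> (\<forall>q. p \<le> q \<and> q < length w \<longrightarrow> 0 < excess i (factor w p q))"
  by (simp add: unmatched_upper_def excess_def)

lemma finite_unmatched [simp]: "finite (unmatched_lower i w)" "finite (unmatched_upper i w)"
  by (auto simp: unmatched_lower_def unmatched_upper_def)

lemma excess_drop_unmatched_upper:
  assumes "p \<in> unmatched_upper i w" shows "0 < excess i (drop p w)"
proof -
  have p: "p < length w" using assms by (simp add: unmatched_upper_excess)
  then have "p \<le> length w - 1" "length w - 1 < length w" by auto
  then have "0 < excess i (factor w p (length w - 1))"
    using assms unfolding unmatched_upper_excess by blast
  moreover have "factor w p (length w - 1) = drop p w"
    using p by (simp add: factor_def)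
  ultimately show ?thesis by simp
qed

text \<open>
  The bracket to look for is the start of the shortest suffix with positive excess: every proper
  suffix of it has excess at most 0, so every factor starting at the same place has positive
  excess.
\<close>

lemma unmatched_upper_after:
  assumes "0 < excess i (drop q w)"
  shows "\<exists>p\<ge>q. p \<in> unmatched_upper i w"
proof -
  let ?S = "{p. q \<le> p \<and> p \<le> length w \<and> 0 < excess i (drop p w)}"
  have fin: "finite ?S" by (rule finite_subset[of _ "{..length w}"]) auto
  have "q \<le> length w" using assms by (cases "q \<le> length w") auto
  then have ne: "?S \<noteq> {}" using assms by auto
  define p where "p = Max ?S"
  have pS: "p \<in> ?S" unfolding p_def by (rule Max_in[OF fin ne])
  have later: "excess i (drop r w) \<le> 0" if "p < r" for r
  proof (cases "r \<le> length w")
    case True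
    show ?thesis
    proof (rule ccontr)
      assume "\<not> ?thesis"
      then have "r \<in> ?S" using True that pS by auto
      then have "r \<le> p" unfolding p_def by (rule Max_ge[OF fin])
      then show False using that by simp
    qed
  qed simp
  have pl: "p < length w" using pS by (cases "p = length w") auto
  have "drop p w = w ! p # drop (Suc p) w" using pl by (simp add: Cons_nth_drop_Suc)
  then have "excess i (drop p w) = excess i [w ! p] + excess i (drop (Suc p) w)"
    by (metis append_Cons append_Nil excess_append)
  then have "0 < excess i [w ! p]" using later[of "Suc p"] pS by simp
  then have "w ! p = i + 1" by (auto simp: excess_single split: if_splits)
  moreover have "0 < excess i (factor w p r)" if "p \<le> r" for r
  proof -
    have "excess i (drop p w) = excess i (factor w p r) + excess i (drop (Suc r) w)"
      using factor_append_drop[OF that, of w] excess_append by metis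
    then show ?thesis using later[of "Suc r"] pS that by simp
  qed
  ultimately have "p \<in> unmatched_upper i w" using pl by (simp add: unmatched_upper_excess)
  then show ?thesis using pS by auto
qed

lemma unmatched_upper_empty:
  "unmatched_upper i w = {} \<longleftrightarrow> (\<forall>q\<le>length w. excess i (drop q w) \<le> 0)"
proof
  assume "unmatched_upper i w = {}"
  then show "\<forall>q\<le>length w. excess i (drop q w) \<le> 0"
    using unmatched_upper_after by (metis empty_iff not_less)
next
  assume *: "\<forall>q\<le>length w. excess i (drop q w) \<le> 0"
  show "unmatched_upper i w = {}"
  proof (rule ccontr)
    assume "unmatched_upper i w \<noteq> {}"
    then obtain p where p: "p \<in> unmatched_upper i w" by auto
    then have "p < length w" by (simp add: unmatched_upper_excess)
    then show False using * excess_drop_unmatched_upper[OF p] by (metis less_imp_le not_less)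
  qed
qed

text \<open>
  This value and that of the next lemma explain which bracket a further letter \<open>i\<close> closes: it
  lowers all suffix excesses by 1, which spoils only the last unmatched opening bracket.
\<close>

lemma excess_drop_Max_unmatched_upper:
  assumes "unmatched_upper i w \<noteq> {}"
  shows "excess i (drop (Max (unmatched_upper i w)) w) = 1"
proof -
  let ?m = "Max (unmatched_upper i w)"
  have m: "?m \<in> unmatched_upper i w" using assms by simp
  then have l: "?m < length w" "w ! ?m = i+1" by (auto simp: unmatched_upper_excess)
  have "excess i (drop (Suc ?m) w) \<le> 0"
  proof (rule ccontr)
    assume "\<not> ?thesis"
    then obtain p where "p \<ge> Suc ?m" "p \<in> unmatched_upper i w"
      using unmatched_upper_after[of i "Suc ?m" w] by auto
    then show False using Max_ge[OF finite_unmatched(2), of p i w] by linarith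
  qed
  moreover have "excess i (drop ?m w) = excess i [w ! ?m] + excess i (drop (Suc ?m) w)"
    using l(1) by (metis append_Cons append_Nil excess_append Cons_nth_drop_Suc)
  ultimately show ?thesis
    using l excess_drop_unmatched_upper[OF m] by (simp add: excess_single)
qed

lemma excess_drop_unmatched_upper_not_last:
  assumes "p \<in> unmatched_upper i w" "r \<in> unmatched_upper i w" "p < r"
  shows "1 < excess i (drop p w)"
proof -
  have "0 < excess i (factor w p (r - 1))"
  proof -
    have "p \<le> r - 1" "r - 1 < length w"
      using assms by (auto simp: unmatched_upper_excess)
    then show ?thesis using assms(1) unfolding unmatched_upper_excess by blast
  qed
  moreover have "factor w p (r - 1) @ drop r w = drop p w"
    using factor_append_drop[of p "r - 1" w] assms(3) by simp
  then have "excess i (drop p w) = excess i (factor w p (r - 1)) + excess i (drop r w)"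
    by (metis excess_append)
  ultimately show ?thesis using excess_drop_unmatched_upper[OF assms(2)] by simp
qed

lemma unmatched_lower_snoc:
  "unmatched_lower i (w @ [u]) =
     unmatched_lower i w \<union> (if u = i \<and> unmatched_upper i w = {} then {length w} else {})"
proof (rule set_eqI)
  fix p
  consider "p < length w" | "p = length w" | "p > length w" by linarith
  then show "p \<in> unmatched_lower i (w @ [u]) \<longleftrightarrow>
     p \<in> unmatched_lower i w \<union> (if u = i \<and> unmatched_upper i w = {} then {length w} else {})"
  proof cases
    case 1
    then show ?thesis by (auto simp: unmatched_lower_excess factor_snoc nth_append)
  next
    case 2
    then show ?thesis
      by (auto simp: unmatched_lower_excess unmatched_upper_empty factor_snoc_last
          excess_append excess_single)
  next
    case 3
    then show ?thesis by (auto simp: unmatched_lower_excess)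
  qed
qed

lemma unmatched_upper_snoc:
  "unmatched_upper i (w @ [u]) =
     (if u = i+1 then insert (length w) (unmatched_upper i w)
      else if u = i then unmatched_upper i w - {Max (unmatched_upper i w)}
      else unmatched_upper i w)"
proof -
  have raw: "p \<in> unmatched_upper i (w @ [u]) \<longleftrightarrow>
      (p \<in> unmatched_upper i w \<and> 0 < excess i (drop p w @ [u])) \<or> (p = length w \<and> u = i+1)" for p
  proof -
    consider "p < length w" | "p = length w" | "p > length w" by linarith
    then show ?thesis
    proof cases
      case 1
      have "(\<forall>q. p \<le> q \<and> q < length (w @ [u]) \<longrightarrow> 0 < excess i (factor (w @ [u]) p q)) \<longleftrightarrow>
         (\<forall>q. p \<le> q \<and> q < length w \<longrightarrow> 0 < excess i (factor w p q)) \<and>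
         0 < excess i (drop p w @ [u])"
        using 1 factor_snoc[of _ w u p] factor_snoc_last[of p w u]
        by (simp add: less_Suc_eq) (metis less_imp_le)
      then show ?thesis
        using 1 unfolding unmatched_upper_excess by (auto simp: nth_append)
    next
      case 2
      then show ?thesis
        by (auto simp: unmatched_upper_excess factor_snoc_last excess_single less_Suc_eq)
    next
      case 3
      then show ?thesis by (auto simp: unmatched_upper_excess)
    qed
  qed
  show ?thesis
  proof (cases "u = i \<and> unmatched_upper i w \<noteq> {}")
    case True
    let ?m = "Max (unmatched_upper i w)"
    have "0 < excess i (drop p w @ [u]) \<longleftrightarrow> p \<noteq> ?m" if p: "p \<in> unmatched_upper i w" for p
    proof (cases "p = ?m")
      case True
      then show ?thesis
        using excess_drop_Max_unmatched_upper[of i w] p \<open>u = i \<and> _\<close>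
        by (auto simp: excess_append excess_single)
    next
      case False
      then have "p < ?m" using Max_ge[OF finite_unmatched(2) p] by simp
      moreover have "?m \<in> unmatched_upper i w" using p by (auto intro!: Max_in)
      ultimately have "1 < excess i (drop p w)"
        using excess_drop_unmatched_upper_not_last[OF p] by simp
      then show ?thesis using False by (auto simp: excess_append excess_single)
    qed
    then show ?thesis using True raw by auto
  next
    case False
    then have "0 < excess i (drop p w @ [u])" if "p \<in> unmatched_upper i w" for p
      using excess_drop_unmatched_upper[OF that] that by (auto simp: excess_append excess_single)
    then show ?thesis using False unfolding set_eq_iff raw by auto
  qed
qed

lemma eps_Nil [simp]: "eps i [] = 0"
  by (simp add: eps_def unmatched_upper_def)

lemma phi_Nil [simp]: "phi i [] = 0"
  by (simp add: phi_def unmatched_lower_def)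

lemma unmatched_bounds:
  "length w \<notin> unmatched_lower i w" "length w \<notin> unmatched_upper i w"
  "p \<in> unmatched_lower i w \<Longrightarrow> p < length w" "p \<in> unmatched_upper i w \<Longrightarrow> p < length w"
  by (auto simp: unmatched_lower_def unmatched_upper_def)

lemma eps_eq_0: "eps i w = 0 \<longleftrightarrow> unmatched_upper i w = {}"
  by (simp add: eps_def)

lemma phi_eq_0: "phi i w = 0 \<longleftrightarrow> unmatched_lower i w = {}"
  by (simp add: phi_def)

text \<open>
  The signature rule as an automaton that reads the word from left to right. With it, every
  statement about crystal operators becomes an induction on the word.
\<close>

lemma eps_snoc [simp]:
  "eps i (w @ [u]) = (if u = i+1 then eps i w + 1 else if u = i then eps i w - 1 else eps i w)"
proof -
  have "card (unmatched_upper i w - {Max (unmatched_upper i w)}) = card (unmatched_upper i w) - 1"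
    by (cases "unmatched_upper i w = {}") (simp_all add: card_Diff_singleton)
  then show ?thesis by (simp add: eps_def unmatched_upper_snoc unmatched_bounds)
qed

lemma phi_snoc [simp]:
  "phi i (w @ [u]) = (if u = i \<and> eps i w = 0 then phi i w + 1 else phi i w)"
  by (auto simp: phi_def eps_eq_0 unmatched_lower_snoc unmatched_bounds)

section \<open>Crystal operators on words\<close>

lemma crystal_f_None: "crystal_f i w = None \<longleftrightarrow> phi i w = 0"
  by (simp add: crystal_f_def phi_eq_0)

lemma crystal_e_None: "crystal_e i w = None \<longleftrightarrow> eps i w = 0"
  by (simp add: crystal_e_def eps_eq_0)

lemma crystal_f_Nil [simp]: "crystal_f i [] = None"
  by (simp add: crystal_f_None)

lemma crystal_e_Nil [simp]: "crystal_e i [] = None"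
  by (simp add: crystal_e_None)

text \<open>
  Only a letter \<open>i\<close> that meets no open bracket becomes the last unmatched \<open>i\<close>; any other letter
  leaves the operator acting on the prefix.
\<close>

lemma crystal_f_snoc:
  "crystal_f i (w @ [u]) =
     (if u = i \<and> eps i w = 0 then Some (w @ [i+1]) else map_option (\<lambda>v. v @ [u]) (crystal_f i w))"
proof (cases "u = i \<and> eps i w = 0")
  case True
  then have "unmatched_lower i (w @ [u]) = insert (length w) (unmatched_lower i w)"
    by (simp add: unmatched_lower_snoc eps_eq_0)
  moreover have "Max (insert (length w) (unmatched_lower i w)) = length w"
    by (rule Max_eqI) (auto dest: unmatched_bounds(3))
  ultimately show ?thesis using True by (simp add: crystal_f_def)
next
  case False
  then have *: "unmatched_lower i (w @ [u]) = unmatched_lower i w"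
    by (auto simp: unmatched_lower_snoc eps_eq_0)
  show ?thesis
  proof (cases "unmatched_lower i w = {}")
    case False
    then have "Max (unmatched_lower i w) < length w"
      using Max_in[OF finite_unmatched(1)] unmatched_bounds(3) by blast
    then show ?thesis using \<open>\<not> (u = i \<and> eps i w = 0)\<close> * False
      by (auto simp: crystal_f_def list_update_append)
  qed (use * False in \<open>auto simp: crystal_f_def\<close>)
qed

text \<open>
  The middle case records that a letter \<open>i\<close> closes the only unmatched \<open>i+1\<close>, if there is one.
  When there are several, it closes the last one, and the first, which is the one to be lowered, survives.
\<close>

lemma crystal_e_snoc:
  "crystal_e i (w @ [u]) =
     (if u = i+1 \<and> eps i w = 0 then Some (w @ [i])
      else if u = i \<and> eps i w \<le> 1 then None
      else map_option (\<lambda>v. v @ [u]) (crystal_e i w))"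
proof -
  let ?U = "unmatched_upper i w"
  have lift: "?thesis" if "unmatched_upper i (w @ [u]) \<noteq> {}" "?U \<noteq> {}"
      "Min (unmatched_upper i (w @ [u])) = Min ?U" "\<not> (u = i \<and> eps i w \<le> 1)"
  proof -
    have "Min ?U < length w" using Min_in[OF finite_unmatched(2) that(2)] unmatched_bounds(4) by blast
    then show ?thesis using that by (auto simp: crystal_e_def list_update_append eps_eq_0)
  qed
  consider "eps i (w @ [u]) = 0" | "u = i+1" "eps i w = 0" | "u = i+1" "eps i w > 0"
    | "u = i" "eps i w > 1" | "u \<noteq> i" "u \<noteq> i+1" "eps i w > 0"
    by (cases "u = i+1"; cases "u = i"; cases "eps i w = 0"; cases "eps i w \<le> 1") auto
  then show ?thesis
  proof cases
    case 1
    then have "crystal_e i (w @ [u]) = None" by (simp add: crystal_e_None)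
    then show ?thesis using 1 crystal_e_None[of i w] by (auto split: if_splits)
  next
    case 2
    then show ?thesis by (simp add: crystal_e_def unmatched_upper_snoc eps_eq_0)
  next
    case 3
    then have ne: "?U \<noteq> {}" by (metis eps_eq_0 less_numeral_extra(3))
    then have "Min ?U < length w" using Min_in[OF finite_unmatched(2)] unmatched_bounds(4) by blast
    then have "Min (insert (length w) ?U) = Min ?U" using ne by simp
    then show ?thesis using 3 ne by (intro lift) (auto simp: unmatched_upper_snoc)
  next
    \<comment> \<open>A second unmatched bracket exists, so removing the last one does not affect the first.\<close>
    case 4
    have ne: "?U \<noteq> {}" using 4 by (metis eps_eq_0 not_less_zero)
    have ne': "?U - {Max ?U} \<noteq> {}"
    proof
      assume "?U - {Max ?U} = {}"
      then have "card ?U \<le> card {Max ?U}" by (intro card_mono) auto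
      then show False using 4 by (simp add: eps_def)
    qed
    have "Min (?U - {Max ?U}) = Min ?U"
    proof (rule Min_eqI)
      obtain r where r: "r \<in> ?U" "r \<noteq> Max ?U" using ne' by auto
      have "Min ?U \<le> r" "r \<le> Max ?U" using r by auto
      then have "Min ?U \<noteq> Max ?U" using r by linarith
      then show "Min ?U \<in> ?U - {Max ?U}" using ne by auto
    qed auto
    then show ?thesis using 4 ne ne' by (intro lift) (auto simp: unmatched_upper_snoc)
  next
    case 5
    then have "?U \<noteq> {}" by (metis eps_eq_0 less_numeral_extra(3))
    then show ?thesis using 5 by (intro lift) (auto simp: unmatched_upper_snoc)
  qed
qed

lemma crystal_f_inverse:
  "crystal_f i w = Some v \<Longrightarrow>
     crystal_e i v = Some w \<and> eps i v = Suc (eps i w) \<and> phi i w = Suc (phi i v)"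
proof (induction w arbitrary: v rule: rev_induct)
  case (snoc u w)
  show ?case
  proof (cases "u = i \<and> eps i w = 0")
    case True
    then have "v = w @ [i+1]" using snoc.prems by (simp add: crystal_f_snoc)
    then show ?thesis using True by (simp add: crystal_e_snoc)
  next
    case False
    then obtain v' where "v = v' @ [u]" "crystal_f i w = Some v'"
      using snoc.prems by (auto simp: crystal_f_snoc)
    then show ?thesis using False snoc.IH[of v'] by (auto simp: crystal_e_snoc)
  qed
qed simp

lemma crystal_e_inverse: "crystal_e i v = Some w \<Longrightarrow> crystal_f i w = Some v"
proof (induction v arbitrary: w rule: rev_induct)
  case (snoc u v)
  show ?case
  proof (cases "u = i+1 \<and> eps i v = 0")
    case True
    then have "w = v @ [i]" using snoc.prems by (simp add: crystal_e_snoc)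
    then show ?thesis using True by (simp add: crystal_f_snoc)
  next
    case False
    then obtain w' where w': "w = w' @ [u]" "crystal_e i v = Some w'" "\<not> (u = i \<and> eps i v \<le> 1)"
      using snoc.prems by (auto simp: crystal_e_snoc split: if_splits)
    then have "crystal_f i w' = Some v" using snoc.IH by simp
    then show ?thesis using False w' crystal_f_inverse[of i w' v] by (auto simp: crystal_f_snoc)
  qed
qed simp

lemma phi_eps_weight: "int (phi i w) - int (eps i w) = int (count_list w i) - int (count_list w (i+1))"
  by (induction w rule: rev_induct) auto

lemma crystal_f_count:
  "crystal_f i w = Some v \<Longrightarrow>
     count_list v i + count_list v (i+1) = count_list w i + count_list w (i+1) \<and>
     (\<forall>j. j \<noteq> i \<and> j \<noteq> i+1 \<longrightarrow> count_list v j = count_list w j)"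
proof (induction w arbitrary: v rule: rev_induct)
  case (snoc u w)
  then show ?case by (fastforce simp: crystal_f_snoc split: if_splits)
qed simp

definition far :: "nat \<Rightarrow> nat \<Rightarrow> bool" where
  "far i j \<longleftrightarrow> i + 1 < j \<or> j + 1 < i"

lemma far_sym: "far i j \<Longrightarrow> far j i"
  by (auto simp: far_def)

lemma crystal_f_far_eps_phi:
  "crystal_f i w = Some v \<Longrightarrow> far i j \<Longrightarrow> eps j v = eps j w \<and> phi j v = phi j w"
proof (induction w arbitrary: v rule: rev_induct)
  case (snoc u w)
  then show ?case by (fastforce simp: crystal_f_snoc far_def split: if_splits)
qed simp

lemma crystal_f_commute:
  "crystal_f i x = Some y \<Longrightarrow> crystal_f j x = Some z \<Longrightarrow> far i j \<Longrightarrow>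
     \<exists>v. crystal_f j y = Some v \<and> crystal_f i z = Some v"
proof (induction x arbitrary: y z rule: rev_induct)
  case (snoc u x)
  have ij: "i \<noteq> j" "i + 1 \<noteq> j" "j + 1 \<noteq> i" using snoc.prems(3) by (auto simp: far_def)
  consider "u = i" "eps i x = 0" | "u = j" "eps j x = 0"
    | "\<not> (u = i \<and> eps i x = 0)" "\<not> (u = j \<and> eps j x = 0)" by argo
  then show ?case
  proof cases
    case 1
    then obtain z' where z': "z = z' @ [u]" "crystal_f j x = Some z'" "y = x @ [i+1]"
      using snoc.prems ij by (auto simp: crystal_f_snoc)
    then have "eps i z' = 0" using crystal_f_far_eps_phi[OF z'(2) far_sym[OF snoc.prems(3)]] 1 by simp
    then show ?thesis using z' 1 ij by (simp add: crystal_f_snoc)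
  next
    case 2
    then obtain y' where y': "y = y' @ [u]" "crystal_f i x = Some y'" "z = x @ [j+1]"
      using snoc.prems ij by (auto simp: crystal_f_snoc)
    then have "eps j y' = 0" using crystal_f_far_eps_phi[OF y'(2) snoc.prems(3)] 2 by simp
    then show ?thesis using y' 2 ij by (simp add: crystal_f_snoc)
  next
    case 3
    then obtain y' z' where yz: "y = y' @ [u]" "crystal_f i x = Some y'"
        "z = z' @ [u]" "crystal_f j x = Some z'"
      using snoc.prems by (auto simp: crystal_f_snoc)
    then obtain v where v: "crystal_f j y' = Some v" "crystal_f i z' = Some v"
      using snoc.IH snoc.prems(3) by blast
    have "eps j y' = eps j x" "eps i z' = eps i x"
      using crystal_f_far_eps_phi[OF yz(2) snoc.prems(3)]
        crystal_f_far_eps_phi[OF yz(4) far_sym[OF snoc.prems(3)]] by auto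
    then show ?thesis using v yz(1,3) 3 by (auto simp: crystal_f_snoc)
  qed
qed simp

section \<open>Row insertion for three consecutive letters\<close>

text \<open>
  Semistandard tableaux with entries \<open>i, i+1, i+2\<close>, given by the multiplicities of the entries:
  \<open>Tab a1 a2 a3 b2 b3 c3\<close> has first row \<open>i\<^bsup>a1\<^esup> (i+1)\<^bsup>a2\<^esup> (i+2)\<^bsup>a3\<^esup>\<close>, second row
  \<open>(i+1)\<^bsup>b2\<^esup> (i+2)\<^bsup>b3\<^esup>\<close> and third row \<open>(i+2)\<^bsup>c3\<^esup>\<close>.
\<close>

datatype tableau = Tab nat nat nat nat nat nat

fun semistandard :: "tableau \<Rightarrow> bool" where
  "semistandard (Tab a1 a2 a3 b2 b3 c3) \<longleftrightarrow> b2 \<le> a1 \<and> b2 + b3 \<le> a1 + a2 \<and> c3 \<le> b2"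

text \<open>
  The signature rule applied to the reading word of the tableau. Index 1 refers to the letters
  \<open>i, i+1\<close>: the \<open>b2\<close> letters \<open>i+1\<close> of the second row match as many letters \<open>i\<close>. The values of the
  operators are meaningful only where \<open>\<phi>\<close> is positive.
\<close>

fun tab_eps1 :: "tableau \<Rightarrow> nat" where "tab_eps1 (Tab a1 a2 a3 b2 b3 c3) = a2"
fun tab_phi1 :: "tableau \<Rightarrow> nat" where "tab_phi1 (Tab a1 a2 a3 b2 b3 c3) = a1 - b2"
fun tab_f1 :: "tableau \<Rightarrow> tableau" where
  "tab_f1 (Tab a1 a2 a3 b2 b3 c3) = Tab (a1 - 1) (a2 + 1) a3 b2 b3 c3"
fun tab_s1 :: "tableau \<Rightarrow> tableau" where
  "tab_s1 (Tab a1 a2 a3 b2 b3 c3) = Tab (b2 + a2) (a1 - b2) a3 b2 b3 c3"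

text \<open>
  Index 2 refers to the letters \<open>i+1, i+2\<close>: the \<open>c3\<close> letters \<open>i+2\<close> of the third row are matched in
  the second row, and the \<open>b3\<close> letters \<open>i+2\<close> of the second row against the \<open>a2\<close> letters \<open>i+1\<close> of
  the first row.
\<close>

fun tab_eps2 :: "tableau \<Rightarrow> nat" where "tab_eps2 (Tab a1 a2 a3 b2 b3 c3) = a3 + (b3 - a2)"
fun tab_phi2 :: "tableau \<Rightarrow> nat" where
  "tab_phi2 (Tab a1 a2 a3 b2 b3 c3) = (b2 - c3) + (a2 - b3)"
fun tab_f2 :: "tableau \<Rightarrow> tableau" where
  "tab_f2 (Tab a1 a2 a3 b2 b3 c3) =
     (if b3 < a2 then Tab a1 (a2 - 1) (a3 + 1) b2 b3 c3 else Tab a1 a2 a3 (b2 - 1) (b3 + 1) c3)"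

text \<open>
  The reversal of the string for index 2. Along the string \<open>f\<close> first changes letters of the first
  row, until \<open>a2 = b3\<close>, and from then on letters of the second row; \<open>t\<close> is the number of letters
  \<open>i+2\<close> in the first row of the reversed tableau.
\<close>

fun tab_s2 :: "tableau \<Rightarrow> tableau" where
  "tab_s2 (Tab a1 a2 a3 b2 b3 c3) =
     (let t = (a2 - b3) + min (b2 - c3) a3
      in Tab a1 (a2 + a3 - t) t (b3 + c3 + t - a2) (b2 - c3 + a2 - t) c3)"

text \<open>
  Robinson--Schensted row insertion. The second component of the result is the number of the row
  in which the new cell appears; a letter outside \<open>i, i+1, i+2\<close> is ignored by the tableau, and the
  letter itself is recorded instead, so that insertion can be undone.
\<close>

fun row_insert :: "nat \<Rightarrow> tableau \<Rightarrow> nat \<Rightarrow> tableau \<times> (nat + nat)" where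
  "row_insert i (Tab a1 a2 a3 b2 b3 c3) u =
     (if u = i then
        (if 0 < a2 then
           (if 0 < b3 then (Tab (a1+1) (a2-1) a3 (b2+1) (b3-1) (c3+1), Inl 3)
            else (Tab (a1+1) (a2-1) a3 (b2+1) b3 c3, Inl 2))
         else if 0 < a3 then (Tab (a1+1) a2 (a3-1) b2 (b3+1) c3, Inl 2)
         else (Tab (a1+1) a2 a3 b2 b3 c3, Inl 1))
      else if u = i+1 then
        (if 0 < a3 then (Tab a1 (a2+1) (a3-1) b2 (b3+1) c3, Inl 2)
         else (Tab a1 (a2+1) a3 b2 b3 c3, Inl 1))
      else if u = i+2 then (Tab a1 a2 (a3+1) b2 b3 c3, Inl 1)
      else (Tab a1 a2 a3 b2 b3 c3, Inr u))"

definition rsk :: "nat \<Rightarrow> nat list \<Rightarrow> tableau \<times> (nat + nat) list" where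
  "rsk i w = foldl (\<lambda>(t, rs) u. let (t', r) = row_insert i t u in (t', rs @ [r]))
     (Tab 0 0 0 0 0 0, []) w"

abbreviation ptab :: "nat \<Rightarrow> nat list \<Rightarrow> tableau" where "ptab i w \<equiv> fst (rsk i w)"
abbreviation qtab :: "nat \<Rightarrow> nat list \<Rightarrow> (nat + nat) list" where "qtab i w \<equiv> snd (rsk i w)"

lemma rsk_Nil [simp]: "rsk i [] = (Tab 0 0 0 0 0 0, [])"
  by (simp add: rsk_def)

lemma rsk_snoc:
  "rsk i (w @ [u]) =
     (fst (row_insert i (ptab i w) u), qtab i w @ [snd (row_insert i (ptab i w) u)])"
  by (simp add: rsk_def split: prod.splits)

lemma insert_semistandard: "semistandard t \<Longrightarrow> semistandard (fst (row_insert i t u))"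
  by (cases t) auto

lemma semistandard_ptab: "semistandard (ptab i w)"
  by (induction w rule: rev_induct) (simp_all add: rsk_snoc insert_semistandard)

lemma insert_inj:
  "row_insert i t u = (t', r) \<Longrightarrow> row_insert i s v = (t', r) \<Longrightarrow> t = s \<and> u = v"
  by (cases t; cases s) (auto split: if_splits)

lemma length_qtab: "length (qtab i w) = length w"
  by (induction w rule: rev_induct) (simp_all add: rsk_snoc)

text \<open>
  The last recorded row tells which cell to remove, and reverse bumping recovers the last letter and
  the previous tableau.
\<close>

lemma rsk_inj: "rsk i w = rsk i v \<Longrightarrow> w = v"
proof (induction w arbitrary: v rule: rev_induct)
  case Nil
  then have "length v = 0" by (metis length_qtab list.size(3))
  then show ?case by simp
next
  case (snoc u w)
  then have "length v = length (w @ [u])" by (metis length_qtab)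
  then obtain v' u' where v: "v = v' @ [u']" by (cases v rule: rev_cases) auto
  have eq: "fst (row_insert i (ptab i w) u) = fst (row_insert i (ptab i v') u')"
    "snd (row_insert i (ptab i w) u) = snd (row_insert i (ptab i v') u')"
    and q: "qtab i w = qtab i v'"
    using snoc.prems unfolding v rsk_snoc by auto
  then have "ptab i w = ptab i v' \<and> u = u'"
    by (intro insert_inj[of i _ _ "fst (row_insert i (ptab i w) u)" "snd (row_insert i (ptab i w) u)"])
      (simp_all add: prod_eq_iff)
  then show ?case using q v snoc.IH[of v'] by (simp add: prod_eq_iff)
qed

lemma eps_ptab: "eps i w = tab_eps1 (ptab i w)"
proof (induction w rule: rev_induct)
  case (snoc u w)
  then show ?case by (cases "ptab i w") (simp add: rsk_snoc)
qed simp

lemma phi_ptab: "phi i w = tab_phi1 (ptab i w)"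
proof (induction w rule: rev_induct)
  case (snoc u w)
  then show ?case using eps_ptab[of i w] semistandard_ptab[of i w]
    by (cases "ptab i w") (auto simp: rsk_snoc)
qed simp

lemma eps_Suc_ptab: "eps (i+1) w = tab_eps2 (ptab i w)"
proof (induction w rule: rev_induct)
  case (snoc u w)
  then show ?case by (cases "ptab i w") (simp add: rsk_snoc)
qed simp

lemma phi_Suc_ptab: "phi (i+1) w = tab_phi2 (ptab i w)"
proof (induction w rule: rev_induct)
  case (snoc u w)
  then show ?case using eps_Suc_ptab[of i w] semistandard_ptab[of i w]
    by (cases "ptab i w") (auto simp add: rsk_snoc)
qed simp

text \<open>
  Row insertion intertwines the crystal operators and leaves the new cell where it was. There are
  two cases, as in the recursion for \<open>f\<close> on words: \<open>f\<close> changes the tableau into which the letter is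
  inserted, or it changes the inserted letter.
\<close>

lemma insert_tab_f1:
  assumes "semistandard t" "0 < tab_phi1 t" "\<not> (u = i \<and> tab_eps1 t = 0)"
  shows "row_insert i (tab_f1 t) u = apfst tab_f1 (row_insert i t u)"
  using assms by (cases t) auto

lemma insert_tab_f1_letter:
  assumes "tab_eps1 t = 0"
  shows "row_insert i t (i+1) = apfst tab_f1 (row_insert i t i)"
  using assms by (cases t) auto

lemma insert_tab_f2:
  assumes "semistandard t" "0 < tab_phi2 t" "\<not> (u = i+1 \<and> tab_eps2 t = 0)"
  shows "row_insert i (tab_f2 t) u = apfst tab_f2 (row_insert i t u)"
  using assms by (cases t) auto

lemma insert_tab_f2_letter:
  assumes "semistandard t" "tab_eps2 t = 0"
  shows "row_insert i t (i+2) = apfst tab_f2 (row_insert i t (i+1))"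
  using assms by (cases t) auto

text \<open>
  This lemma and the next transfer the rank 2 crystal structure from words to tableaux: the insertion
  tableau is moved by the operator of the same index, and the recording list does not change.
\<close>

lemma rsk_crystal_f:
  "crystal_f i w = Some v \<Longrightarrow> rsk i v = apfst tab_f1 (rsk i w)"
proof (induction w arbitrary: v rule: rev_induct)
  case (snoc u w)
  show ?case
  proof (cases "u = i \<and> eps i w = 0")
    case True
    then have "v = w @ [i+1]" using snoc.prems by (simp add: crystal_f_snoc)
    then show ?thesis using True insert_tab_f1_letter[of "ptab i w" i]
      by (simp add: rsk_snoc eps_ptab)
  next
    case False
    then obtain v' where v: "v = v' @ [u]" "crystal_f i w = Some v'"
      using snoc.prems by (auto simp: crystal_f_snoc)
    have "0 < tab_phi1 (ptab i w)"
      using v(2) crystal_f_inverse[of i w v'] by (simp add: phi_ptab)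
    then show ?thesis
      using False v snoc.IH[OF v(2)] insert_tab_f1[OF semistandard_ptab, of i w u i]
      by (simp add: rsk_snoc eps_ptab)
  qed
qed simp

lemma rsk_crystal_f_Suc:
  "crystal_f (i+1) w = Some v \<Longrightarrow> rsk i v = apfst tab_f2 (rsk i w)"
proof (induction w arbitrary: v rule: rev_induct)
  case (snoc u w)
  show ?case
  proof (cases "u = i+1 \<and> eps (i+1) w = 0")
    case True
    then have "v = w @ [i+2]" using snoc.prems by (simp add: crystal_f_snoc)
    then show ?thesis using True insert_tab_f2_letter[OF semistandard_ptab, of i w i]
      unfolding eps_Suc_ptab by (simp add: rsk_snoc)
  next
    case False
    then obtain v' where v: "v = v' @ [u]" "crystal_f (i+1) w = Some v'"
      using snoc.prems by (auto simp: crystal_f_snoc)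
    have "0 < tab_phi2 (ptab i w)"
      using crystal_f_inverse[OF v(2)] unfolding phi_Suc_ptab by simp
    then show ?thesis
      using False v snoc.IH[OF v(2)] insert_tab_f2[OF semistandard_ptab, of i w u i]
      unfolding eps_Suc_ptab by (simp add: rsk_snoc)
  qed
qed simp

section \<open>Strings and reflections in rank 2\<close>

text \<open>
  A tableau is determined by its string and its position on it. These are complete invariants of
  the strings of index 1 and 2; the position is given by \<open>\<epsilon>\<close>.
\<close>

fun tab_inv1 :: "tableau \<Rightarrow> nat list" where
  "tab_inv1 (Tab a1 a2 a3 b2 b3 c3) = [a1 + a2, a3, b2, b3, c3]"
fun tab_inv2 :: "tableau \<Rightarrow> nat list" where
  "tab_inv2 (Tab a1 a2 a3 b2 b3 c3) = [a1, min a2 b3, a2 + a3, b2 + b3, c3]"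

lemma tab_inv1_f1: "0 < tab_phi1 t \<Longrightarrow> tab_inv1 (tab_f1 t) = tab_inv1 t"
  by (cases t) auto

lemma tab_inv2_f2: "semistandard t \<Longrightarrow> 0 < tab_phi2 t \<Longrightarrow> tab_inv2 (tab_f2 t) = tab_inv2 t"
  by (cases t) (auto simp: min_def)

lemma tab_s1_unique:
  assumes "semistandard t" "semistandard t'" "tab_inv1 t' = tab_inv1 t" "tab_eps1 t' = tab_phi1 t"
  shows "t' = tab_s1 t"
  using assms by (cases t; cases t') auto

text \<open>
  This sum is the key quantity in rank 2. On a semistandard tableau it equals
  \<open>a1 + a2 + a3 - c3 + \<bar>a1 - b2 - b3\<bar>\<close>, and \<open>f\<close> for index 2 preserves \<open>a1\<close>, \<open>a2 + a3\<close>, \<open>b2 + b3\<close>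
  and \<open>c3\<close>. The two string lengths of which it consists are not invariant separately.
\<close>

definition tab_sum :: "tableau \<Rightarrow> nat" where
  "tab_sum t = tab_eps1 t + tab_phi1 t + (tab_eps2 (tab_s1 t) + tab_phi2 (tab_s1 t))"

lemma tab_sum_f2: "semistandard t \<Longrightarrow> 0 < tab_phi2 t \<Longrightarrow> tab_sum (tab_f2 t) = tab_sum t"
  by (cases t) (auto simp: tab_sum_def)

text \<open>
  On the part of the string where \<open>f\<close> changes the first row the invariant \<open>min a2 b3\<close> is \<open>b3\<close>, on
  the other part it is \<open>a2\<close>. The tableau and its mirror image may lie on either part.
\<close>

lemma tab_s2_unique:
  assumes "semistandard t" "semistandard t'" "tab_inv2 t' = tab_inv2 t" "tab_eps2 t' = tab_phi2 t"
  shows "t' = tab_s2 t"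
proof -
  obtain a1 a2 a3 b2 b3 c3 where t: "t = Tab a1 a2 a3 b2 b3 c3" by (cases t)
  obtain a1' a2' a3' b2' b3' c3' where t': "t' = Tab a1' a2' a3' b2' b3' c3'" by (cases t')
  have c: "c3 \<le> b2" "c3 \<le> b2'" using assms unfolding t t' by auto
  \<comment> \<open>Writing b2 as a sum avoids truncated subtraction.\<close>
  then obtain y y' where y: "b2 = c3 + y" "b2' = c3 + y'" by (auto simp: le_iff_add)
  show ?thesis
  proof (cases "a2 \<le> b3"; cases "a2' \<le> b3'"; cases "y \<le> a3")
  qed (use assms in \<open>simp_all add: t t' y Let_def min_def\<close>; linarith)+
qed


text \<open>
  In the coordinates \<open>x = a1 - b2\<close>, \<open>a = a2\<close>, \<open>d = a3\<close>, \<open>y = b2 - c3\<close>, \<open>e = b3\<close> the reflections do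
  not involve \<open>c3\<close>, and the first one just exchanges \<open>x\<close> and \<open>a\<close>. Over the integers the braid
  relation is an identity between piecewise linear maps.
\<close>

type_synonym coords = "int \<times> int \<times> int \<times> int \<times> int"

fun tab_of :: "nat \<Rightarrow> coords \<Rightarrow> tableau" where
  "tab_of c (x, a, d, y, e) = Tab (nat (int c + y + x)) (nat a) (nat d) (nat (int c + y)) (nat e) c"

fun admissible :: "coords \<Rightarrow> bool" where
  "admissible (x, a, d, y, e) \<longleftrightarrow> 0 \<le> x \<and> 0 \<le> a \<and> 0 \<le> d \<and> 0 \<le> y \<and> 0 \<le> e \<and> e \<le> x + a"

fun coord_s1 :: "coords \<Rightarrow> coords" where
  "coord_s1 (x, a, d, y, e) = (a, x, d, y, e)"

fun coord_s2 :: "coords \<Rightarrow> coords" where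
  "coord_s2 (x, a, d, y, e) =
     (let t = max (a - e) 0 + min y d in (x + y + a - e - t, a + d - t, t, e - a + t, y + a - t))"

lemma ex_admissible_coords:
  assumes "semistandard t" obtains c v where "t = tab_of c v" "admissible v"
proof -
  obtain a1 a2 a3 b2 b3 c3 where t: "t = Tab a1 a2 a3 b2 b3 c3" by (cases t)
  have "t = tab_of c3 (int a1 - int b2, int a2, int a3, int b2 - int c3, int b3)"
       "admissible (int a1 - int b2, int a2, int a3, int b2 - int c3, int b3)"
    using assms unfolding t by auto
  then show ?thesis by (rule that)
qed

lemma coord_s1:
  "admissible v \<Longrightarrow> admissible (coord_s1 v) \<and> tab_s1 (tab_of c v) = tab_of c (coord_s1 v)"
  by (cases v) (auto simp: nat_add_distrib)

lemma admissible_coord_s2: "admissible v \<Longrightarrow> admissible (coord_s2 v)"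
  by (cases v) (auto simp: Let_def)

lemma tab_of_coord_s2:
  "admissible v \<Longrightarrow> tab_s2 (tab_of c v) = tab_of c (coord_s2 v)"
proof (cases v)
  case (fields x a d y e)
  assume "admissible v"
  then have v: "0 \<le> x" "0 \<le> a" "0 \<le> d" "0 \<le> y" "0 \<le> e" "e \<le> x + a"
    unfolding fields by auto
  define t where "t = max (a - e) 0 + min y d"
  have t: "0 \<le> t" "t \<le> a + d" "a - e \<le> t" "t \<le> y + a"
    using v unfolding t_def by auto
  have "nat (int c + y) - c = nat y" using v by linarith
  moreover have "nat a - nat e = nat (max (a - e) 0)" "min (nat y) (nat d) = nat (min y d)"
    using v by linarith+
  ultimately have nat_t: "(nat a - nat e) + min (nat (int c + y) - c) (nat d) = nat t"
    using v unfolding t_def by (simp add: nat_add_distrib)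
  have parts: "nat a + nat d - nat t = nat (a + d - t)"
    "nat e + c + nat t - nat a = nat (int c + (e - a + t))"
    "nat (int c + y) - c + nat a - nat t = nat (y + a - t)"
    "int c + (e - a + t) + (x + y + a - e - t) = int c + y + x"
    using v t by linarith+
  show ?thesis
    unfolding fields tab_of.simps tab_s2.simps coord_s2.simps Let_def t_def[symmetric] nat_t parts by (rule refl)
qed

lemma coord_braid:
  "admissible v \<Longrightarrow> coord_s1 (coord_s2 (coord_s1 v)) = coord_s2 (coord_s1 (coord_s2 v))"
proof (cases v)
  case (fields x a d y e)
  assume "admissible v"
  then show ?thesis
    unfolding fields coord_s1.simps coord_s2.simps admissible.simps Let_def prod.inject by (smt (verit))
qed

lemma tab_braid:
  assumes "semistandard t" shows "tab_s1 (tab_s2 (tab_s1 t)) = tab_s2 (tab_s1 (tab_s2 t))"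
proof -
  obtain c v where t: "t = tab_of c v" and v: "admissible v" using ex_admissible_coords[OF assms] .
  show ?thesis
    unfolding t by (simp add: v coord_s1 admissible_coord_s2 tab_of_coord_s2 coord_braid)
qed

section \<open>The Weyl group action on words\<close>

lemma iterate_0 [simp]: "iterate g 0 b = Some b"
  by (simp add: iterate_def)

lemma iterate_Suc [simp]: "iterate g (Suc N) b = Option.bind (iterate g N b) g"
  by (simp add: iterate_def)

lemma iterate_invariant:
  assumes "\<And>x y. g x = Some y \<Longrightarrow> F y = F x"
  shows "iterate g N b = Some v \<Longrightarrow> F v = F b"
  by (induction N arbitrary: v) (auto simp: bind_eq_Some_conv dest: assms)

text \<open>
  Used with \<open>R\<close> the graph of an operator that commutes with \<open>g\<close>.
\<close>

lemma iterate_transport: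
  assumes "\<And>x y z. g x = Some z \<Longrightarrow> R x y \<Longrightarrow> \<exists>v. g y = Some v \<and> R z v"
  shows "iterate g N x = Some z \<Longrightarrow> R x y \<Longrightarrow> \<exists>v. iterate g N y = Some v \<and> R z v"
  by (induction N arbitrary: z) (fastforce simp: bind_eq_Some_conv dest: assms)+

lemma iterate_crystal_f:
  "N \<le> phi i b \<Longrightarrow>
     \<exists>v. iterate (crystal_f i) N b = Some v \<and> phi i v + N = phi i b \<and> eps i v = eps i b + N"
proof (induction N)
  case (Suc N)
  then obtain v where v: "iterate (crystal_f i) N b = Some v" "phi i v + N = phi i b"
      "eps i v = eps i b + N" by auto
  then have "phi i v \<noteq> 0" using Suc.prems by simp
  then obtain u where u: "crystal_f i v = Some u" using crystal_f_None by fastforce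
  then show ?case using v crystal_f_inverse[OF u] by auto
qed simp

lemma iterate_crystal_e:
  "N \<le> eps i b \<Longrightarrow>
     \<exists>v. iterate (crystal_e i) N b = Some v \<and> eps i v + N = eps i b \<and> phi i v = phi i b + N"
proof (induction N)
  case (Suc N)
  then obtain v where v: "iterate (crystal_e i) N b = Some v" "eps i v + N = eps i b"
      "phi i v = phi i b + N" by auto
  then have "eps i v \<noteq> 0" using Suc.prems by simp
  then obtain u where u: "crystal_e i v = Some u" using crystal_e_None by fastforce
  then show ?case using v crystal_f_inverse[OF crystal_e_inverse[OF u]] by auto
qed simp

lemma iterate_crystal_e_defined: "iterate (crystal_e i) N b \<noteq> None \<longleftrightarrow> N \<le> eps i b"
proof
  show "N \<le> eps i b \<Longrightarrow> iterate (crystal_e i) N b \<noteq> None"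
    using iterate_crystal_e by fastforce
next
  assume *: "iterate (crystal_e i) N b \<noteq> None"
  show "N \<le> eps i b"
  proof (rule ccontr)
    assume "\<not> N \<le> eps i b"
    then obtain d where d: "N = Suc (eps i b) + d" by (metis less_iff_Suc_add not_le add_Suc)
    obtain v where v: "iterate (crystal_e i) (eps i b) b = Some v" "eps i v = 0"
      using iterate_crystal_e[of "eps i b" i b] by auto
    have "iterate (crystal_e i) (Suc (eps i b) + d) b = None"
      by (induction d) (use v crystal_e_None in auto)
    then show False using * d by simp
  qed
qed

text \<open>
  The action of \<open>s\<^sub>i\<close>, written without reference to the rank: the pairing of the weight with the
  simple coroot is \<open>\<phi> - \<epsilon>\<close>.
\<close>

definition string_refl :: "nat \<Rightarrow> nat list \<Rightarrow> nat list" where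
  "string_refl i b =
     (if eps i b \<le> phi i b then the (iterate (crystal_f i) (phi i b - eps i b) b)
      else the (iterate (crystal_e i) (eps i b - phi i b) b))"

lemma simple_action_string_refl:
  assumes "i \<in> {1..n}" shows "simple_action n i b = string_refl i b"
proof -
  have "coroot_pairing (wt n b) (i, i) = int (phi i b) - int (eps i b)"
    using assms by (simp add: coroot_pairing_def wt_def phi_eps_weight)
  then show ?thesis by (auto simp: simple_action_def string_refl_def Let_def nat_diff_distrib')
qed

lemma string_refl_cases:
  obtains N where "N + eps i b = phi i b" "iterate (crystal_f i) N b = Some (string_refl i b)"
  | N where "N + phi i b = eps i b" "iterate (crystal_e i) N b = Some (string_refl i b)"
proof (cases "eps i b \<le> phi i b")
  case True
  then have "iterate (crystal_f i) (phi i b - eps i b) b = Some (string_refl i b)"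
    using iterate_crystal_f[of "phi i b - eps i b" i b] by (auto simp: string_refl_def)
  then show ?thesis using True by (intro that(1)[of "phi i b - eps i b"]) auto
next
  case False
  then have "iterate (crystal_e i) (eps i b - phi i b) b = Some (string_refl i b)"
    using iterate_crystal_e[of "eps i b - phi i b" i b] by (auto simp: string_refl_def)
  then show ?thesis using False by (intro that(2)[of "eps i b - phi i b"]) auto
qed

lemma eps_phi_string_refl [simp]:
  "eps i (string_refl i b) = phi i b" "phi i (string_refl i b) = eps i b"
proof -
  have "eps i (string_refl i b) = phi i b \<and> phi i (string_refl i b) = eps i b"
  proof (cases rule: string_refl_cases[of i b])
    case (1 N)
    then show ?thesis using iterate_crystal_f[of N i b] by auto
  next
    case (2 N)
    then show ?thesis using iterate_crystal_e[of N i b] by auto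
  qed
  then show "eps i (string_refl i b) = phi i b" "phi i (string_refl i b) = eps i b" by auto
qed

text \<open>
  A quantity that is constant along the edges of \<open>f\<^sub>i\<close> is constant on \<open>i\<close>-strings. Numbers of
  letters, recording lists and the invariants of tableau strings are quantities of this kind.
\<close>

lemma string_refl_invariant:
  assumes "\<And>x y. crystal_f i x = Some y \<Longrightarrow> F y = F x"
  shows "F (string_refl i b) = F b"
proof (cases rule: string_refl_cases[of i b])
  case 1
  then show ?thesis using iterate_invariant[of "crystal_f i" F] assms by blast
next
  case 2
  have "F y = F x" if "crystal_e i x = Some y" for x y
    using assms[OF crystal_e_inverse[OF that]] by simp
  then show ?thesis using iterate_invariant[of "crystal_e i" F] 2 by blast
qed

lemma string_refl_count:
  "count_list (string_refl i b) i = count_list b (i+1)"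
  "count_list (string_refl i b) (i+1) = count_list b i"
  "j \<noteq> i \<Longrightarrow> j \<noteq> i+1 \<Longrightarrow> count_list (string_refl i b) j = count_list b j"
proof -
  have "count_list (string_refl i b) i + count_list (string_refl i b) (i+1) =
      count_list b i + count_list b (i+1)"
    by (rule string_refl_invariant[of i "\<lambda>w. count_list w i + count_list w (i+1)"])
      (use crystal_f_count in blast)
  then show "count_list (string_refl i b) i = count_list b (i+1)"
     "count_list (string_refl i b) (i+1) = count_list b i"
    using phi_eps_weight[of i b] phi_eps_weight[of i "string_refl i b"] by simp_all
  show "j \<noteq> i \<Longrightarrow> j \<noteq> i+1 \<Longrightarrow> count_list (string_refl i b) j = count_list b j"
    by (rule string_refl_invariant[of i "\<lambda>w. count_list w j"]) (use crystal_f_count in blast)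
qed

lemma eps_phi_string_refl_far:
  assumes "far i j"
  shows "eps j (string_refl i b) = eps j b" "phi j (string_refl i b) = phi j b"
  using string_refl_invariant[of i "eps j" b] string_refl_invariant[of i "phi j" b]
    crystal_f_far_eps_phi[OF _ assms] by blast+

lemma rsk_string_refl: "rsk i (string_refl i b) = apfst tab_s1 (rsk i b)"
proof -
  have "(\<lambda>w. (tab_inv1 (ptab i w), qtab i w)) (string_refl i b) =
        (\<lambda>w. (tab_inv1 (ptab i w), qtab i w)) b"
  proof (rule string_refl_invariant)
    fix x y assume xy: "crystal_f i x = Some y"
    then have "0 < tab_phi1 (ptab i x)" using crystal_f_inverse[OF xy] by (simp add: phi_ptab)
    then show "(tab_inv1 (ptab i y), qtab i y) = (tab_inv1 (ptab i x), qtab i x)"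
      using rsk_crystal_f[OF xy] by (simp add: tab_inv1_f1)
  qed
  moreover have "tab_eps1 (ptab i (string_refl i b)) = tab_phi1 (ptab i b)"
    using eps_phi_string_refl(1)[of i b] unfolding eps_ptab phi_ptab .
  ultimately show ?thesis
    using tab_s1_unique[OF semistandard_ptab semistandard_ptab, of i "string_refl i b" i b]
    by (simp add: prod_eq_iff)
qed

lemma rsk_string_refl_Suc: "rsk i (string_refl (i+1) b) = apfst tab_s2 (rsk i b)"
proof -
  have "(\<lambda>w. (tab_inv2 (ptab i w), qtab i w)) (string_refl (i+1) b) =
        (\<lambda>w. (tab_inv2 (ptab i w), qtab i w)) b"
  proof (rule string_refl_invariant)
    fix x y assume xy: "crystal_f (i+1) x = Some y"
    then have "0 < tab_phi2 (ptab i x)" using crystal_f_inverse[OF xy] unfolding phi_Suc_ptab by simp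
    then show "(tab_inv2 (ptab i y), qtab i y) = (tab_inv2 (ptab i x), qtab i x)"
      using rsk_crystal_f_Suc[OF xy] by (simp add: tab_inv2_f2 semistandard_ptab)
  qed
  moreover have "tab_eps2 (ptab i (string_refl (i+1) b)) = tab_phi2 (ptab i b)"
    using eps_phi_string_refl(1)[of "i+1" b] unfolding eps_Suc_ptab phi_Suc_ptab .
  ultimately show ?thesis
    using tab_s2_unique[OF semistandard_ptab semistandard_ptab, of i "string_refl (i+1) b" i b]
    by (simp add: prod_eq_iff)
qed

lemma string_refl_involution [simp]: "string_refl i (string_refl i b) = b"
proof (rule rsk_inj[of i])
  have "tab_s1 (tab_s1 t) = t" if "semistandard t" for t
    using that by (cases t) auto
  then show "rsk i (string_refl i (string_refl i b)) = rsk i b"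
    by (simp add: rsk_string_refl semistandard_ptab prod_eq_iff)
qed

text \<open>
  Both sides have the same recording list, so the relation for tableaux suffices.
\<close>

lemma string_refl_braid:
  "string_refl i (string_refl (i+1) (string_refl i b)) =
   string_refl (i+1) (string_refl i (string_refl (i+1) b))"
proof (rule rsk_inj[of i])
  show "rsk i (string_refl i (string_refl (i+1) (string_refl i b))) =
   rsk i (string_refl (i+1) (string_refl i (string_refl (i+1) b)))"
    unfolding rsk_string_refl rsk_string_refl_Suc
    by (simp add: tab_braid semistandard_ptab prod_eq_iff)
qed

section \<open>String lengths under crystal operators and reflections\<close>

definition string_length :: "nat \<Rightarrow> nat list \<Rightarrow> nat" where
  "string_length i b = eps i b + phi i b"

lemma string_length_crystal_f: "crystal_f i b = Some b' \<Longrightarrow> string_length i b' = string_length i b"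
  using crystal_f_inverse[of i b b'] by (simp add: string_length_def)

lemma string_length_crystal_f_far:
  "crystal_f i b = Some b' \<Longrightarrow> far i j \<Longrightarrow> string_length j b' = string_length j b"
  using crystal_f_far_eps_phi[of i b b' j] by (simp add: string_length_def)

lemma string_length_string_refl_far: "far i j \<Longrightarrow> string_length j (string_refl i b) = string_length j b"
  by (simp add: string_length_def eps_phi_string_refl_far)

lemma string_length_sum_crystal_f:
  assumes "crystal_f (i+1) b = Some b'"
  shows "string_length i b' + string_length (i+1) (string_refl i b') =
         string_length i b + string_length (i+1) (string_refl i b)"
proof -
  have tab: "string_length i w + string_length (i+1) (string_refl i w) = tab_sum (ptab i w)" for w
    unfolding string_length_def tab_sum_def eps_Suc_ptab phi_Suc_ptab eps_ptab[of i]
      phi_ptab[of i] rsk_string_refl by simp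
  have "0 < tab_phi2 (ptab i b)"
    using crystal_f_inverse[OF assms] unfolding phi_Suc_ptab by simp
  then show ?thesis
    unfolding tab rsk_crystal_f_Suc[OF assms] by (simp add: tab_sum_f2 semistandard_ptab)
qed

lemma crystal_e_f_commute:
  assumes "crystal_e i x = Some z" "crystal_f j x = Some y" "far i j"
  shows "\<exists>v. crystal_e i y = Some v \<and> crystal_f j z = Some v"
proof -
  have fz: "crystal_f i z = Some x" using assms(1) by (rule crystal_e_inverse)
  then have "phi j z \<noteq> 0"
    using crystal_f_far_eps_phi[OF fz assms(3)] crystal_f_inverse[OF assms(2)] by simp
  then obtain v where v: "crystal_f j z = Some v" using crystal_f_None by fastforce
  then have "crystal_f i v = Some y"
    using crystal_f_commute[OF fz v assms(3)] assms(2) by auto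
  then show ?thesis using v crystal_f_inverse by blast
qed

text \<open>
  Here \<open>s\<^sub>i\<close> takes the same number of steps from \<open>x\<close> and from \<open>y\<close>, since \<open>f\<^sub>j\<close> does not affect
  \<open>\<epsilon>\<^sub>i\<close> and \<open>\<phi>\<^sub>i\<close>; each step commutes with \<open>f\<^sub>j\<close>.
\<close>

lemma crystal_f_string_refl:
  assumes xy: "crystal_f j x = Some y" and far: "far i j"
  shows "crystal_f j (string_refl i x) = Some (string_refl i y)"
proof -
  have eq: "eps i y = eps i x" "phi i y = phi i x"
    using crystal_f_far_eps_phi[OF xy far_sym[OF far]] by auto
  show ?thesis
  proof (cases rule: string_refl_cases[of i x])
    case (1 N)
    have "\<exists>v. iterate (crystal_f i) N y = Some v \<and> crystal_f j (string_refl i x) = Some v"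
      by (rule iterate_transport[of "crystal_f i" "\<lambda>x y. crystal_f j x = Some y", OF _ 1(2) xy])
        (use crystal_f_commute[OF _ _ far] in blast)
    moreover have "N = phi i y - eps i y" using 1(1) eq by simp
    ultimately show ?thesis using 1(1) eq by (auto simp: string_refl_def[of i y])
  next
    case (2 N)
    have "\<exists>v. iterate (crystal_e i) N y = Some v \<and> crystal_f j (string_refl i x) = Some v"
      by (rule iterate_transport[of "crystal_e i" "\<lambda>x y. crystal_f j x = Some y", OF _ 2(2) xy])
        (rule crystal_e_f_commute[OF _ _ far])
    moreover have "N = eps i y - phi i y" using 2(1) eq by simp
    ultimately show ?thesis using 2(1) eq by (auto simp: string_refl_def[of i y])
  qed
qed

lemma string_refl_commute:
  assumes far: "far i j"
  shows "string_refl j (string_refl i x) = string_refl i (string_refl j x)"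
proof -
  have f: "crystal_f j (string_refl i u) = Some (string_refl i v)" if "crystal_f j u = Some v" for u v
    using crystal_f_string_refl[OF that far] .
  have e: "crystal_e j (string_refl i u) = Some (string_refl i v)" if "crystal_e j u = Some v" for u v
    using crystal_f_inverse[OF f[OF crystal_e_inverse[OF that]]] by simp
  note eq = eps_phi_string_refl_far[OF far, of x]
  show ?thesis
  proof (cases rule: string_refl_cases[of j x])
    case (1 N)
    have "\<exists>v. iterate (crystal_f j) N (string_refl i x) = Some v \<and> v = string_refl i (string_refl j x)"
      by (rule iterate_transport[of "crystal_f j" "\<lambda>x y. y = string_refl i x", OF _ 1(2) refl])
        (use f in auto)
    moreover have "N = phi j x - eps j x" using 1(1) by simp
    ultimately show ?thesis using 1(1) eq by (simp add: string_refl_def[of j "string_refl i x"])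
  next
    case (2 N)
    have "\<exists>v. iterate (crystal_e j) N (string_refl i x) = Some v \<and> v = string_refl i (string_refl j x)"
      by (rule iterate_transport[of "crystal_e j" "\<lambda>x y. y = string_refl i x", OF _ 2(2) refl])
        (use e in auto)
    moreover have "N = eps j x - phi j x" using 2(1) by simp
    ultimately show ?thesis using 2(1) eq by (auto simp: string_refl_def[of j "string_refl i x"])
  qed
qed

definition string_refls :: "nat list \<Rightarrow> nat list \<Rightarrow> nat list" where
  "string_refls is b = foldr string_refl is b"

lemma string_refls_simps [simp]:
  "string_refls [] b = b"
  "string_refls (i # is) b = string_refl i (string_refls is b)"
  "string_refls (is @ js) b = string_refls is (string_refls js b)"
  by (simp_all add: string_refls_def)

lemma word_action_string_refls: "set is \<subseteq> {1..n} \<Longrightarrow> word_action n is b = string_refls is b"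
  by (induction "is") (auto simp: word_action_def simple_action_string_refl)

lemma string_refls_rev [simp]:
  "string_refls is (string_refls (rev is) b) = b"
  "string_refls (rev is) (string_refls is b) = b"
  by (induction "is" arbitrary: b) auto

lemma string_refls_commute:
  "\<forall>m\<in>set is. far i m \<Longrightarrow> string_refls is (string_refl i b) = string_refl i (string_refls is b)"
proof (induction "is")
  case (Cons m "is")
  then have "far i m" and "string_refls is (string_refl i b) = string_refl i (string_refls is b)"
    by simp_all
  then show ?case by (simp add: string_refl_commute[of i m])
qed simp

lemma crystal_f_string_refls:
  "crystal_f i b = Some b' \<Longrightarrow> \<forall>m\<in>set is. far i m \<Longrightarrow>
     crystal_f i (string_refls is b) = Some (string_refls is b')"
proof (induction "is")
  case (Cons m "is")
  then have "far i m" and "crystal_f i (string_refls is b) = Some (string_refls is b')"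
    by simp_all
  then show ?case by (simp add: crystal_f_string_refl far_sym[OF \<open>far i m\<close>])
qed simp

section \<open>Root strings\<close>

text \<open>
  The modified operators for \<open>\<alpha>\<^sub>j + \<dots> + \<alpha>\<^sub>k\<close> are conjugates of those for \<open>\<alpha>\<^sub>k\<close>, so their string
  through \<open>b\<close> has the length of a \<open>k\<close>-string.
\<close>

definition root_length :: "nat \<Rightarrow> nat \<Rightarrow> nat list \<Rightarrow> nat" where
  "root_length j k b = string_length k (string_refls (rev [j..<k]) b)"

text \<open>
  The roots ending at a given \<open>k > i\<close> are permuted by \<open>s\<^sub>i\<close> through their first index. For
  \<open>j \<in> {i, i+1}\<close> this is built into the definition of the modified operators. For \<open>j < i\<close> the root
  is fixed by \<open>s\<^sub>i\<close>: with \<open>p = i - 1\<close>, the reflection \<open>s\<^sub>i\<close> passes through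
  \<open>s\<^sub>p\<^sub>-\<^sub>1 \<dots> s\<^sub>j\<close>, and the braid relation turns \<open>s\<^sub>i s\<^sub>p s\<^sub>i\<close> into
  \<open>s\<^sub>p s\<^sub>i s\<^sub>p\<close>, whose leftmost factor commutes with all that is applied after it, including the
  operators for \<open>k\<close>.
  Without the restriction \<open>i < k\<close> such an equivariance fails: in the adjoint crystal of
  \<open>SL\<^sub>3\<close>, the vector of weight 0 on the string of \<open>\<alpha>\<^sub>1\<close> is fixed by the Weyl group, but its strings
  for \<open>\<alpha>\<^sub>1\<close> and \<open>\<alpha>\<^sub>1 + \<alpha>\<^sub>2\<close>, which \<open>s\<^sub>2\<close> exchanges, have lengths 2 and 0.
\<close>

lemma root_length_string_refl:
  assumes "i < k" "j \<le> k"
  shows "root_length j k (string_refl i b) = root_length (transpose i (i+1) j) k b"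
proof -
  have first: "rev [i..<k] = rev [i+1..<k] @ [i]"
    using assms(1) by (simp add: upt_conv_Cons)
  consider "j < i" | "j = i" | "j = i+1" | "j > i+1" by linarith
  then show ?thesis
  proof cases
    case 1
    then obtain p where p: "i = p + 1" "j \<le> p" by (cases i) auto
    let ?U = "rev [i+1..<k]" and ?x = "string_refls (rev [j..<p]) b"
    have "[j..<k] = [j..<p] @ [p..<k]"
      using p assms by (metis Suc_eq_plus1 less_imp_le Suc_lessD upt_add_eq_append le_add_diff_inverse)
    also have "[p..<k] = p # i # [i+1..<k]" using p assms(1) by (simp add: upt_conv_Cons)
    finally have *: "rev [j..<k] = ?U @ [i, p] @ rev [j..<p]" by simp
    have x: "string_refls (rev [j..<p]) (string_refl i b) = string_refl i ?x"
      by (rule string_refls_commute) (auto simp: far_def p)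
    have braid: "string_refl i (string_refl p (string_refl i ?x)) =
        string_refl p (string_refl i (string_refl p ?x))"
      unfolding p(1) string_refl_braid ..
    have U: "string_refls ?U (string_refl p y) = string_refl p (string_refls ?U y)" for y
      by (rule string_refls_commute) (auto simp: far_def p)
    have "far p k" using p assms(1) by (auto simp: far_def)
    then have "root_length j k (string_refl i b) = root_length j k b"
      unfolding root_length_def * string_refls_simps x braid U by (simp add: string_length_string_refl_far)
    then show ?thesis using 1 by (simp add: transpose_def)
  next
    case 2
    then show ?thesis unfolding root_length_def by (simp add: first)
  next
    case 3
    then show ?thesis unfolding root_length_def by (simp add: first)
  next
    case 4
    have "string_refls (rev [j..<k]) (string_refl i b) = string_refl i (string_refls (rev [j..<k]) b)"
      by (rule string_refls_commute) (use 4 in \<open>auto simp: far_def\<close>)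
    moreover have "far i k" using 4 assms by (auto simp: far_def)
    ultimately show ?thesis using 4
      by (simp add: root_length_def string_length_string_refl_far transpose_def)
  qed
qed

definition column_length :: "nat \<Rightarrow> nat list \<Rightarrow> nat" where
  "column_length k b = (\<Sum>j = 1..k. root_length j k b)"

lemma column_length_string_refl:
  assumes "1 \<le> i" "i < k"
  shows "column_length k (string_refl i b) = column_length k b"
proof -
  have "transpose i (i+1) permutes {1..k}"
    using assms by (intro permutes_swap_id) auto
  then have "column_length k b = (\<Sum>j = 1..k. root_length (transpose i (i+1) j) k b)"
    unfolding column_length_def by (subst sum.permute) (simp_all add: o_def)
  also have "\<dots> = column_length k (string_refl i b)"
    unfolding column_length_def using assms by (intro sum.cong) (simp_all add: root_length_string_refl)
  finally show ?thesis by simp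
qed

lemma column_length_crystal_f_less:
  assumes "crystal_f i b = Some b'" "k + 1 < i"
  shows "column_length k b' = column_length k b"
  unfolding column_length_def
proof (rule sum.cong)
  fix j assume "j \<in> {1..k}"
  have "crystal_f i (string_refls (rev [j..<k]) b) = Some (string_refls (rev [j..<k]) b')"
    by (rule crystal_f_string_refls[OF assms(1)]) (use assms(2) in \<open>auto simp: far_def\<close>)
  then show "root_length j k b' = root_length j k b"
    unfolding root_length_def by (rule string_length_crystal_f_far) (use assms in \<open>auto simp: far_def\<close>)
qed simp

text \<open>
  Each root ending at \<open>i\<close> is paired with the root with the same first index that ends at \<open>i+1\<close>.
  Once \<open>s\<^sub>i\<^sub>-\<^sub>1 \<dots> s\<^sub>j\<close>, which commutes with \<open>f\<^sub>i\<^sub>+\<^sub>1\<close>, is applied to the word, the two lengths are those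
  of the rank 2 invariant. The root \<open>\<alpha>\<^sub>i\<^sub>+\<^sub>1\<close> remains, and its string is the one that \<open>f\<^sub>i\<^sub>+\<^sub>1\<close> moves along.
\<close>

lemma column_length_pair_crystal_f:
  assumes "crystal_f (i+1) b = Some b'"
  shows "column_length i b' + column_length (i+1) b' = column_length i b + column_length (i+1) b"
proof -
  have col: "column_length i w + column_length (i+1) w =
      (\<Sum>j = 1..i. root_length j i w + root_length j (i+1) w) + string_length (i+1) w" for w
    by (simp add: column_length_def sum.distrib root_length_def)
  have "root_length j i b' + root_length j (i+1) b' = root_length j i b + root_length j (i+1) b"
    if "j \<in> {1..i}" for j
  proof -
    have "crystal_f (i+1) (string_refls (rev [j..<i]) b) = Some (string_refls (rev [j..<i]) b')"
      by (rule crystal_f_string_refls[OF assms]) (auto simp: far_def)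
    from string_length_sum_crystal_f[OF this] show ?thesis
      using that by (simp add: root_length_def)
  qed
  then show ?thesis unfolding col using string_length_crystal_f[OF assms] by simp
qed

text \<open>
  The roots are grouped by their last index; the term for \<open>k = 0\<close> is an empty sum, which lets the
  pairing of \<open>i\<close> with \<open>i+1\<close> apply to \<open>i = 0\<close> too.
\<close>

definition total_length :: "nat \<Rightarrow> nat list \<Rightarrow> nat" where
  "total_length n b = (\<Sum>k\<le>n. column_length k b)"

lemma total_length_crystal_f:
  assumes "crystal_f i b = Some b'" "1 \<le> i"
  shows "total_length i b' = total_length i b"
proof -
  obtain m where m: "i = m + 1" using assms(2) by (metis add.commute le_iff_add)
  have tot: "total_length i w = (\<Sum>k<m. column_length k w) + (column_length m w + column_length (m+1) w)" for w
    by (simp add: total_length_def m lessThan_Suc_atMost[symmetric])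
  have "(\<Sum>k<m. column_length k b') = (\<Sum>k<m. column_length k b)"
    by (rule sum.cong) (simp_all add: column_length_crystal_f_less[OF assms(1)] m)
  then show ?thesis
    unfolding tot using column_length_pair_crystal_f[of m b b'] assms(1) m by simp
qed

lemma total_length_string_refl:
  assumes "1 \<le> i" "i \<le> n"
  shows "total_length n (string_refl i b) = total_length n b"
proof -
  have "{..n} = {..i} \<union> {i<..n}" using assms by auto
  then have tot: "total_length n w = total_length i w + (\<Sum>k\<in>{i<..n}. column_length k w)" for w
    unfolding total_length_def by (simp add: sum.union_disjoint Int_def)
  have "total_length i (string_refl i b) = total_length i b"
    by (rule string_refl_invariant) (rule total_length_crystal_f[OF _ assms(1)])
  then show ?thesis
    unfolding tot using assms(1) by (simp add: column_length_string_refl)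
qed

lemma total_length_string_refls:
  "set is \<subseteq> {1..n} \<Longrightarrow> total_length n (string_refls is b) = total_length n b"
  by (induction "is") (auto simp: total_length_string_refl)

section \<open>The atomic number as a sum of string lengths\<close>

lemma iterate_conjugate:
  assumes "\<And>x. p (q x) = x" "\<And>x. q (p x) = x"
  shows "iterate (\<lambda>b. map_option p (g (q b))) N b = map_option p (iterate g N (q b))"
proof (induction N)
  case (Suc N)
  then show ?case by (cases "iterate g N (q b)") (simp_all add: assms)
qed (simp add: assms)

lemma root_eps_string_refls:
  assumes "1 \<le> j" "j \<le> k" "k \<le> n"
  shows "root_eps n (j, k) b = eps k (string_refls (rev [j..<k]) b)"
proof -
  have "set [j..<k] \<subseteq> {1..n}" "set (rev [j..<k]) \<subseteq> {1..n}" using assms by auto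
  then have "root_e n (j, k) =
      (\<lambda>b. map_option (string_refls [j..<k]) (crystal_e k (string_refls (rev [j..<k]) b)))"
    unfolding root_e_def by (simp add: word_action_string_refls cong: map_option_cong)
  then have "iterate (root_e n (j, k)) N b \<noteq> None \<longleftrightarrow> N \<le> eps k (string_refls (rev [j..<k]) b)" for N
    using iterate_crystal_e_defined[of k N "string_refls (rev [j..<k]) b"]
    by (simp add: iterate_conjugate)
  then have "{N. iterate (root_e n (j, k)) N b \<noteq> None} = {..eps k (string_refls (rev [j..<k]) b)}"
    by auto
  then show ?thesis unfolding root_eps_def by (simp add: Max_eq_iff)
qed

lemma coroot_pairing_wt:
  assumes "1 \<le> j" "j \<le> k" "k \<le> n"
  shows "coroot_pairing (wt n b) (j, k) = int (count_list b j) - int (count_list b (k+1))"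
  using assms(2,3)
proof (induction k rule: dec_induct)
  case base
  then show ?case using assms(1) by (simp add: coroot_pairing_def wt_def)
next
  case (step k)
  then show ?case using assms(1) by (simp add: coroot_pairing_def wt_def)
qed

lemma count_string_refls:
  assumes "j \<le> k"
  shows "count_list (string_refls (rev [j..<k]) b) k = count_list b j"
    "m > k \<Longrightarrow> count_list (string_refls (rev [j..<k]) b) m = count_list b m"
proof -
  have "count_list (string_refls (rev [j..<k]) b) k = count_list b j \<and>
    (\<forall>m>k. count_list (string_refls (rev [j..<k]) b) m = count_list b m)"
    using assms
  proof (induction k rule: dec_induct)
    case (step k)
    then show ?case using string_refl_count(2)[of k] string_refl_count(3)[of _ k] by simp
  qed simp
  then show "count_list (string_refls (rev [j..<k]) b) k = count_list b j"
    "m > k \<Longrightarrow> count_list (string_refls (rev [j..<k]) b) m = count_list b m" by auto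
qed

text \<open>
  At \<open>x = s\<^sub>k\<^sub>-\<^sub>1 \<dots> s\<^sub>j(b)\<close> the pairing of the weight with the simple coroot of index \<open>k\<close> is
  \<open>\<phi>\<^sub>k - \<epsilon>\<^sub>k\<close>, and it equals the pairing of the weight of \<open>b\<close> with the coroot of the given root.
\<close>

lemma half_root_length:
  assumes "1 \<le> j" "j \<le> k" "k \<le> n"
  shows "real_of_int (coroot_pairing (wt n b) (j, k)) / 2 + real (root_eps n (j, k) b) =
         real (root_length j k b) / 2"
proof -
  let ?x = "string_refls (rev [j..<k]) b"
  have "coroot_pairing (wt n b) (j, k) = int (phi k ?x) - int (eps k ?x)"
    using coroot_pairing_wt[OF assms] phi_eps_weight[of k ?x] count_string_refls[OF assms(2)] by simp
  then show ?thesis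
    by (simp add: root_eps_string_refls[OF assms] root_length_def string_length_def field_simps)
qed

lemma sum_positive_roots:
  "(\<Sum>\<alpha>\<in>positive_roots n. g \<alpha>) = (\<Sum>k = 1..n. \<Sum>j = 1..k. g (j, k))"
proof -
  have "positive_roots n = prod.swap ` (SIGMA k:{1..n}. {1..k})"
    by (force simp: positive_roots_def)
  then have "(\<Sum>\<alpha>\<in>positive_roots n. g \<alpha>) = (\<Sum>(k, j)\<in>(SIGMA k:{1..n}. {1..k}). g (j, k))"
    by (simp add: sum.reindex) (simp add: split_def prod.swap_def)
  then show ?thesis by (simp add: sum.Sigma)
qed

lemma atomic_number_total_length: "atomic_number n b = real (total_length n b) / 2"
proof -
  have "atomic_number n b = (\<Sum>k = 1..n. \<Sum>j = 1..k.
      real_of_int (coroot_pairing (wt n b) (j, k)) / 2 + real (root_eps n (j, k) b))"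
    by (simp add: atomic_number_def rho_check_pairing_def sum_positive_roots sum.distrib
        sum_divide_distrib sum_distrib_left)
  also have "\<dots> = (\<Sum>k = 1..n. \<Sum>j = 1..k. real (root_length j k b) / 2)"
    by (intro sum.cong) (auto simp: half_root_length)
  also have "\<dots> = (\<Sum>k = 1..n. real (column_length k b)) / 2"
    by (simp add: column_length_def sum_divide_distrib)
  also have "(\<Sum>k = 1..n. real (column_length k b)) = real (total_length n b)"
  proof -
    have "(\<Sum>k\<le>n. column_length k b) = column_length 0 b + (\<Sum>k = 1..n. column_length k b)"
      by (simp add: atMost_atLeast0 sum.atLeast_Suc_atMost)
    then show ?thesis by (simp add: total_length_def column_length_def)
  qed
  finally show ?thesis .
qed

lemma atomic_number_edge:
  assumes "1 \<le> n" "(b, b') \<in> graph_edges n lam"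
  shows "atomic_number n b = atomic_number n b'"
proof -
  have "total_length n b = total_length n b'"
    using assms total_length_string_refls[of _ n b'] total_length_crystal_f[of n]
    by (auto simp: graph_edges_def weyl_action_def word_action_string_refls)
  then show ?thesis by (simp add: atomic_number_total_length)
qed

theorem theorem2:
  fixes n :: nat and lam :: weight
  assumes "1 \<le> n"
    and "lam \<in> dominant_weights n"
    and "C \<in> graph_components n lam"
    and "b \<in> C" and "b' \<in> C"
  shows "atomic_number n b = atomic_number n b'"
proof -
  obtain x where C: "C = (graph_edges n lam \<union> (graph_edges n lam)\<inverse>)\<^sup>* `` {x}"
    using assms(3) by (auto simp: graph_components_def quotient_def)
  have "atomic_number n x = atomic_number n y" if "y \<in> C" for y
  proof -
    have "(x, y) \<in> (graph_edges n lam \<union> (graph_edges n lam)\<inverse>)\<^sup>*" using that C by simp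
    then show ?thesis
      by (induction rule: rtrancl_induct) (use atomic_number_edge[OF assms(1)] in fastforce)+
  qed
  then show ?thesis using assms(4,5) by metis
qed

end
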